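(* Let $(H,\langle\cdot,\cdot\rangle)$ be a finite nonsingular symplectic abelian group. Then its isometry group is generated by the set of transvections in it.
   Context: Abelian groups are written additively. A pairing on an abelian group $H$ is a $\mathbb{Z}$-bilinear map $\langle\cdot,\cdot\rangle:H\times H\to\mathbb{C}^{\times}$ (a homomorphism in each variable from the additive group $H$ to the multiplicative group $\mathbb{C}^{\times}$); it is anti-symmetric if $\langle a,b\rangle=\langle b,a\rangle^{-1}$ for all $a,b\in H$. A symplectic abelian group is an abelian group $H$ together with an anti-symmetric pairing $\langle\cdot,\cdot\rangle$ of $H$ into $\mathbb{C}^\times$. It is nonsingular if $\langle a,b\rangle=1$ for all $b\in H$ implies $a=0$. An isometry is a group isomorphism preserving the pairings, and the isometry group $\mathrm{Sp}(H)$ is the group of all isometries of $H$ onto itself. Let $\omega_m=e^{2\pi i/m}$. For $b\in H$ with $b\neq 0$ of order $m$ and $a\in H$, the value $\langle b,a\rangle$ lies in the cyclic group generated by $\omega_m$, so $\langle b,a\rangle=\omega_m^{j}$ for some $j\in\mathbb{Z}$ (unique mod $m$), and one sets $\langle b,a\rangle\cdot b:=jb$. For $b\in H$ with $b\neq 0$ and $k\in\mathbb{Z}$, the homomorphism $s_{b,k}:H\to H$, $a\mapsto a-k(\langle b,a\rangle\cdot b)$, is called a transvection on $H$. *)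

theory Defs
  imports Complex_Main "HOL-Algebra.Algebra"
begin

text \<open>
  Abelian groups are HOL-Algebra's \<^locale>\<open>comm_group\<close>s, hence written multiplicatively: \<open>a \<otimes> b\<close>,
  \<open>\<one>\<close>, \<open>inv a\<close> and \<open>b [^] (k::int)\<close> stand for \<open>a + b\<close>, \<open>0\<close>, \<open>- a\<close> and \<open>k b\<close>.
  A pairing takes values in the nonzero complex numbers; its values outside the carrier are
  irrelevant.  The pairing is anti-symmetric only, not alternating, so \<open>pairing a a = - 1\<close> is allowed.
\<close>

locale symplectic_abelian_group = comm_group H for H (structure) +
  fixes pairing :: "'a \<Rightarrow> 'a \<Rightarrow> complex"
  assumes pairing_nonzero:
      "\<lbrakk>a \<in> carrier H; b \<in> carrier H\<rbrakk> \<Longrightarrow> pairing a b \<noteq> 0"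
    and pairing_mult_left:
      "\<lbrakk>a \<in> carrier H; b \<in> carrier H; c \<in> carrier H\<rbrakk> \<Longrightarrow>
        pairing (a \<otimes> b) c = pairing a c * pairing b c"
    and pairing_mult_right:
      "\<lbrakk>a \<in> carrier H; b \<in> carrier H; c \<in> carrier H\<rbrakk> \<Longrightarrow>
        pairing a (b \<otimes> c) = pairing a b * pairing a c"
    and pairing_antisym:
      "\<lbrakk>a \<in> carrier H; b \<in> carrier H\<rbrakk> \<Longrightarrow> pairing a b = inverse (pairing b a)"

definition (in symplectic_abelian_group) nonsingular :: bool where
  "nonsingular \<longleftrightarrow> (\<forall>a\<in>carrier H. (\<forall>b\<in>carrier H. pairing a b = 1) \<longrightarrow> a = \<one>)"

definition isometries ::
    "('a, 'c) monoid_scheme \<Rightarrow> ('a \<Rightarrow> 'a \<Rightarrow> complex) \<Rightarrow>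
     ('b, 'd) monoid_scheme \<Rightarrow> ('b \<Rightarrow> 'b \<Rightarrow> complex) \<Rightarrow> ('a \<Rightarrow> 'b) set" where
  "isometries G p H q =
     {f \<in> iso G H. \<forall>a\<in>carrier G. \<forall>b\<in>carrier G. q (f a) (f b) = p a b}"

text \<open>
  As in \<^const>\<open>AutoGroup\<close>, maps are normalised to be \<^const>\<open>extensional\<close> on the carrier, so that
  equality of elements means equality of maps on \<open>H\<close>.
\<close>

definition (in symplectic_abelian_group) Sp :: "('a \<Rightarrow> 'a) monoid" where
  "Sp = BijGroup (carrier H)
     \<lparr>carrier := isometries H pairing H pairing \<inter> extensional (carrier H)\<rparr>"

definition root_of_unity :: "nat \<Rightarrow> complex" where
  "root_of_unity m = exp (2 * of_real pi * \<i> / of_nat m)"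

text \<open>
  The element \<open>\<langle>b, a\<rangle> \<cdot> b\<close>.  It is meaningful for \<open>b\<close> of finite order, and then does not depend on
  the chosen exponent: see \<open>pairing_exponent_exists\<close> and \<open>pairing_scale_eq\<close> below.
\<close>

definition (in symplectic_abelian_group) pairing_scale :: "'a \<Rightarrow> 'a \<Rightarrow> 'a" where
  "pairing_scale b a = b [^] (SOME j::int. pairing b a = root_of_unity (ord b) powi j)"

definition (in symplectic_abelian_group) transvection :: "'a \<Rightarrow> int \<Rightarrow> 'a \<Rightarrow> 'a" where
  "transvection b k = (\<lambda>a\<in>carrier H. a \<otimes> inv (pairing_scale b a [^] k))"

definition (in symplectic_abelian_group) transvections :: "('a \<Rightarrow> 'a) set" where
  "transvections = {transvection b k | b k. b \<in> carrier H \<and> b \<noteq> \<one>}"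

lemma root_of_unity_powi: "root_of_unity m powi j = cis (2 * pi * of_int j / real m)"
proof -
  have "root_of_unity m = cis (2 * pi / real m)"
    by (simp add: root_of_unity_def cis_conv_exp mult_ac)
  then show ?thesis
    by (simp add: Complex.cis_power_int mult_ac)
qed

lemma root_of_unity_powi_eq_1_iff:
  assumes "m > 0"
  shows "root_of_unity m powi j = 1 \<longleftrightarrow> int m dvd j"
proof
  assume "root_of_unity m powi j = 1"
  then have "cos (2 * pi * of_int j / real m) = 1"
    by (simp add: root_of_unity_powi complex_eq_iff)
  then obtain n :: int where "2 * pi * of_int j / real m = of_int n * 2 * pi"
    by (auto simp: cos_one_2pi_int)
  with assms have "real_of_int j = real_of_int (n * int m)"
    by (simp add: field_simps)
  then have "j = n * int m"
    by (simp only: of_int_eq_iff)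
  then show "int m dvd j" by simp
next
  assume "int m dvd j"
  then obtain n where n: "j = int m * n" by (rule dvdE)
  have "2 * pi * of_int j / real m = 2 * pi * of_int n"
    using assms by (simp add: n)
  then show "root_of_unity m powi j = 1"
    by (simp add: root_of_unity_powi)
qed

lemma root_of_unity_powi_eq_iff:
  assumes "m > 0"
  shows "root_of_unity m powi i = root_of_unity m powi j \<longleftrightarrow> int m dvd i - j"
proof -
  have "root_of_unity m \<noteq> 0"
    by (simp add: root_of_unity_def)
  then have "root_of_unity m powi i = root_of_unity m powi j \<longleftrightarrow> root_of_unity m powi (i - j) = 1"
    by (simp add: power_int_diff)
  then show ?thesis
    using root_of_unity_powi_eq_1_iff[OF assms] by simp
qed

context symplectic_abelian_group
begin

lemma pairing_one_left: "a \<in> carrier H \<Longrightarrow> pairing \<one> a = 1"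
  using pairing_mult_left[of \<one> \<one> a] pairing_nonzero[of \<one> a] by simp

lemma pairing_pow_left:
  "\<lbrakk>b \<in> carrier H; a \<in> carrier H\<rbrakk> \<Longrightarrow> pairing (b [^] (n::nat)) a = pairing b a ^ n"
  by (induction n) (simp_all add: pairing_one_left pairing_mult_left)

lemma pairing_exponent_exists:
  assumes "b \<in> carrier H" "a \<in> carrier H" "ord b > 0"
  shows "\<exists>j::int. pairing b a = root_of_unity (ord b) powi j"
proof -
  have "pairing b a ^ ord b = 1"
    using assms pairing_pow_left[of b a "ord b"] by (simp add: pairing_one_left)
  then have "pairing b a \<in> (\<lambda>k. cis (2 * pi * real k / real (ord b))) ` {..<ord b}"
    using bij_betw_roots_unity[OF assms(3)] by (simp add: bij_betw_def)
  then obtain k :: nat where "pairing b a = cis (2 * pi * real k / real (ord b))"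
    by auto
  then have "pairing b a = root_of_unity (ord b) powi int k"
    by (simp only: root_of_unity_powi of_int_of_nat_eq)
  then show ?thesis by blast
qed

lemma pairing_scale_eq:
  assumes "b \<in> carrier H" "ord b > 0" "pairing b a = root_of_unity (ord b) powi j"
  shows "pairing_scale b a = b [^] (j::int)"
proof -
  let ?i = "SOME j::int. pairing b a = root_of_unity (ord b) powi j"
  have "pairing b a = root_of_unity (ord b) powi ?i"
    using assms(3) by (rule someI)
  then have "int (ord b) dvd j - ?i"
    using assms(3) root_of_unity_powi_eq_iff[OF assms(2), of j ?i] by simp
  then show ?thesis
    unfolding pairing_scale_def using assms(1) by (metis int_pow_eq dvd_diff_commute)
qed

lemma pairing_scale_closed: "b \<in> carrier H \<Longrightarrow> pairing_scale b a \<in> carrier H"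
  by (simp add: pairing_scale_def)

lemma pairing_scale_mult:
  assumes "b \<in> carrier H" "ord b > 0" "a \<in> carrier H" "c \<in> carrier H"
  shows "pairing_scale b (a \<otimes> c) = pairing_scale b a \<otimes> pairing_scale b c"
proof -
  obtain i j :: int where ij: "pairing b a = root_of_unity (ord b) powi i"
      "pairing b c = root_of_unity (ord b) powi j"
    using pairing_exponent_exists assms by metis
  have "root_of_unity (ord b) \<noteq> 0"
    by (simp add: root_of_unity_def)
  then have "pairing b (a \<otimes> c) = root_of_unity (ord b) powi (i + j)"
    using assms ij by (simp add: pairing_mult_right power_int_add)
  then show ?thesis
    using assms ij pairing_scale_eq int_pow_mult by metis
qed

lemma transvection_hom:
  assumes "b \<in> carrier H" "ord b > 0"
  shows "transvection b k \<in> hom H H"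
proof (rule homI)
  fix a c assume ac: "a \<in> carrier H" "c \<in> carrier H"
  let ?x = "pairing_scale b a [^] k" and ?y = "pairing_scale b c [^] k"
  have cl: "?x \<in> carrier H" "?y \<in> carrier H"
    using assms by (simp_all add: pairing_scale_closed)
  have "pairing_scale b (a \<otimes> c) [^] k = ?x \<otimes> ?y"
    using assms ac by (simp add: pairing_scale_mult int_pow_distrib pairing_scale_closed)
  then show "transvection b k (a \<otimes> c) = transvection b k a \<otimes> transvection b k c"
    using ac cl by (simp add: transvection_def inv_mult m_ac)
qed (use assms in \<open>simp add: transvection_def pairing_scale_closed\<close>)

lemma subgroup_Sp: "subgroup (carrier Sp) (BijGroup (carrier H))"
proof -
  interpret B: group "BijGroup (carrier H)" by (rule group_BijGroup)
  have mem: "f \<in> carrier Sp \<longleftrightarrow>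
      f \<in> auto H \<and> (\<forall>a\<in>carrier H. \<forall>b\<in>carrier H. pairing (f a) (f b) = pairing a b)" for f
    by (auto simp: Sp_def isometries_def iso_def auto_def Bij_def)
  have sub: "f \<in> Bij (carrier H)" if "f \<in> carrier Sp" for f
    using that by (simp add: mem auto_def)
  show ?thesis
  proof (rule B.subgroupI)
    show "carrier Sp \<subseteq> carrier (BijGroup (carrier H))"
      using sub by (auto simp: BijGroup_def)
    show "carrier Sp \<noteq> {}"
      using id_in_auto mem[of "\<lambda>x\<in>carrier H. x"] by auto
  next
    fix f assume f: "f \<in> carrier Sp"
    have "inv\<^bsub>BijGroup (carrier H)\<^esub> f \<in> auto H"
      using f mem subgroup.m_inv_closed[OF subgroup_auto] by blast
    moreover have "pairing (inv_into (carrier H) f a) (inv_into (carrier H) f b) = pairing a b"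
      if "a \<in> carrier H" "b \<in> carrier H" for a b
    proof -
      have im: "f ` carrier H = carrier H"
        using sub[OF f] by (simp add: Bij_def bij_betw_def)
      then have "inv_into (carrier H) f a \<in> carrier H" "inv_into (carrier H) f b \<in> carrier H"
        "f (inv_into (carrier H) f a) = a" "f (inv_into (carrier H) f b) = b"
        using that by (auto intro: inv_into_into f_inv_into_f)
      then show ?thesis
        using f mem by metis
    qed
    ultimately show "inv\<^bsub>BijGroup (carrier H)\<^esub> f \<in> carrier Sp"
      using sub[OF f] by (simp add: mem inv_BijGroup)
  next
    fix f g assume fg: "f \<in> carrier Sp" "g \<in> carrier Sp"
    have "f \<otimes>\<^bsub>BijGroup (carrier H)\<^esub> g \<in> auto H"
      using fg mem subgroup.m_closed[OF subgroup_auto] by blast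
    then show "f \<otimes>\<^bsub>BijGroup (carrier H)\<^esub> g \<in> carrier Sp"
      using fg Bij_imp_funcset[OF sub[OF fg(2)]] sub
      by (simp add: mem BijGroup_def compose_def Pi_iff)
  qed
qed

lemma group_Sp: "group Sp"
proof -
  have "Sp = BijGroup (carrier H)\<lparr>carrier := carrier Sp\<rparr>"
    by (simp add: Sp_def)
  then show ?thesis
    using subgroup.subgroup_is_group[OF subgroup_Sp group_BijGroup] by simp
qed

end

end

theory Submission
  imports Defs
begin

text \<open>
  Write \<open>q a\<close> for \<open>pairing a a\<close>; anti-symmetry makes \<open>q\<close> a homomorphism into \<open>{1, -1}\<close>.  A transvection
  along \<open>b\<close> preserves the pairing as soon as \<open>q b = 1\<close>, and if moreover \<open>pairing b z\<close> has the same
  order as \<open>b\<close>, then some transvection along \<open>b\<close> moves \<open>z\<close> to \<open>z \<otimes> inv b\<close> while it fixes everything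
  orthogonal to \<open>b\<close> (\<open>shift_by_transvection\<close>).
  
  Given an isometry \<open>f\<close> that fixes a set \<open>K\<close> pointwise, one composes it with transvections until it
  also fixes a given element \<open>a\<close>.  The difference \<open>d = f a \<otimes> inv a\<close> is orthogonal to \<open>K\<close> and
  satisfies \<open>q d = 1\<close>.  If \<open>pairing d a\<close> has full order, one shift along \<open>d\<close> is enough; otherwise a
  detour through \<open>a \<otimes> u\<close> works, for any \<open>u\<close> orthogonal to \<open>K\<close> whose pairings with \<open>a\<close> and \<open>f a\<close>
  both have full order (\<open>fix_one_more\<close>).
  
  Suppose that \<open>H\<close> is the product of \<open>K\<close> and its orthogonal complement and that \<open>q\<close> is trivial on
  this complement.  The complement then contains a hyperbolic pair \<open>x, y\<close> of \<open>p\<close>-elements; \<open>f\<close> is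
  made to fix first \<open>x\<close> and then \<open>y\<close>, the plane they span is absorbed into \<open>K\<close>, and induction on the
  size of the complement shows that \<open>f\<close> is a product of transvections (\<open>trans_group_if_fixes\<close>).
  
  It remains to find a starting set \<open>K\<close>.  There is a unique \<open>c\<close> with \<open>q a = pairing c a\<close> for all \<open>a\<close>
  (\<open>pairing_self_represented\<close>), so every isometry fixes \<open>c\<close>, and \<open>q\<close> is trivial on every complement
  of a set that contains \<open>c\<close>.  If \<open>c = \<one>\<close> take \<open>K = {\<one>}\<close>; if \<open>q c = -1\<close> take \<open>K = {\<one>, c}\<close>.  If
  \<open>c \<noteq> \<one>\<close> but \<open>q c = 1\<close>, then \<open>c\<close> is not split off by itself.  Write \<open>c\<close> as a \<open>2 ^ h\<close>-th power of
  some \<open>e\<close> with \<open>h\<close> as large as possible.  By maximality \<open>e\<close> has a hyperbolic partner \<open>y\<close>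
  (\<open>power_free_partner\<close>), and \<open>f\<close> can be made to fix \<open>e\<close> and \<open>y\<close>, whose plane contains \<open>c\<close>.
\<close>

section \<open>Roots of unity of prime power order\<close>

lemma prime_power_dvd_exponent:
  fixes w :: complex
  assumes "Factorial_Ring.prime p" "w ^ (p ^ Suc n) = 1" "w ^ (p ^ n) \<noteq> 1" "w ^ m = 1"
  shows "p ^ Suc n dvd m"
proof (cases "m = 0")
  case False
  define g where "g = gcd m (p ^ Suc n)"
  obtain a b where ab: "m * a = p ^ Suc n * b + g"
    using bezout_nat[OF False, of "p ^ Suc n"] unfolding g_def by auto
  have "w ^ (p ^ Suc n * b + g) = 1"
    unfolding ab[symmetric] power_mult assms(4) by simp
  then have wg: "w ^ g = 1"
    unfolding power_add power_mult assms(2) by simp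
  have "g dvd p ^ Suc n" by (simp add: g_def)
  then obtain i where i: "i \<le> Suc n" "g = p ^ i"
    using divides_primepow_nat[OF assms(1)] by blast
  have "i = Suc n"
  proof (rule ccontr)
    assume "i \<noteq> Suc n"
    then have "g dvd p ^ n" using i by (simp add: le_imp_power_dvd)
    then obtain k where "p ^ n = g * k" by (rule dvdE)
    then have "w ^ (p ^ n) = 1" by (simp add: power_mult wg)
    then show False using assms(3) by simp
  qed
  then have "g = p ^ Suc n" using i(2) by simp
  then show ?thesis unfolding g_def by (metis gcd_dvd1)
qed simp

lemma root_of_unity_as_power:
  fixes w v :: complex
  assumes "N > 0" "w ^ N = 1" "v ^ N = 1" and prim: "\<And>m. w ^ m = 1 \<Longrightarrow> N dvd m"
  shows "\<exists>i. v = w ^ i"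
proof -
  have w0: "w \<noteq> 0" using assms(1,2) by (metis power_0_left zero_neq_one not_gr_zero)
  have "inj_on (\<lambda>i. w ^ i) {..<N}"
  proof (rule linorder_inj_onI)
    fix i j assume ij: "i < j" "i \<in> {..<N}" "j \<in> {..<N}"
    show "w ^ i \<noteq> w ^ j"
    proof
      assume "w ^ i = w ^ j"
      also have "w ^ j = w ^ i * w ^ (j - i)" using ij by (simp flip: power_add)
      finally have "w ^ (j - i) = 1" using w0 by simp
      then have "N dvd j - i" by (rule prim)
      then show False using ij by (auto dest: dvd_imp_le)
    qed
  qed auto
  then have "card ((\<lambda>i. w ^ i) ` {..<N}) = N" by (simp add: card_image)
  moreover have "card {z::complex. z ^ N = 1} = N"
    using assms(1) by (rule card_roots_unity_eq)
  moreover have "(\<lambda>i. w ^ i) ` {..<N} \<subseteq> {z. z ^ N = 1}"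
    using assms(2) by (auto simp flip: power_mult simp: mult.commute[of _ N] power_mult)
  moreover have "finite {z::complex. z ^ N = 1}"
    using assms(1) finite_roots_unity by blast
  ultimately have "(\<lambda>i. w ^ i) ` {..<N} = {z. z ^ N = 1}"
    by (metis card_subset_eq)
  then show ?thesis using assms(3) by blast
qed

section \<open>Elementary properties of the pairing and of isometries\<close>

context symplectic_abelian_group
begin

lemma pairing_one_right: "a \<in> carrier H \<Longrightarrow> pairing a \<one> = 1"
  using pairing_antisym[of a \<one>] by (simp add: pairing_one_left)

lemma pairing_pow_right:
  "\<lbrakk>a \<in> carrier H; b \<in> carrier H\<rbrakk> \<Longrightarrow> pairing a (b [^] (n::nat)) = pairing a b ^ n"
  by (induction n) (simp_all add: pairing_one_right pairing_mult_right)

lemma pairing_inv_right: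
  assumes "a \<in> carrier H" "b \<in> carrier H"
  shows "pairing a (inv b) = inverse (pairing a b)"
proof -
  have "pairing a b * pairing a (inv b) = 1"
    using assms by (simp flip: pairing_mult_right add: pairing_one_right)
  then show ?thesis by (metis inverse_unique)
qed

lemma pairing_inv_left:
  assumes "a \<in> carrier H" "b \<in> carrier H"
  shows "pairing (inv a) b = inverse (pairing a b)"
proof -
  have "pairing a b * pairing (inv a) b = 1"
    using assms by (simp flip: pairing_mult_left add: pairing_one_left)
  then show ?thesis by (metis inverse_unique)
qed

lemma pairing_eq_1_sym:
  "\<lbrakk>a \<in> carrier H; b \<in> carrier H\<rbrakk> \<Longrightarrow> pairing a b = 1 \<longleftrightarrow> pairing b a = 1"
  by (metis pairing_antisym inverse_1 inverse_inverse_eq)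

text \<open>
  The cross terms \<open>pairing a b\<close> and \<open>pairing b a\<close> cancel by anti-symmetry.
\<close>

lemma pairing_self_mult:
  assumes "a \<in> carrier H" "b \<in> carrier H"
  shows "pairing (a \<otimes> b) (a \<otimes> b) = pairing a a * pairing b b"
  using assms pairing_nonzero[of b a] pairing_antisym[of a b]
  by (simp add: pairing_mult_left pairing_mult_right)

lemma pairing_self_inv: "a \<in> carrier H \<Longrightarrow> pairing (inv a) (inv a) = pairing a a"
  by (simp add: pairing_inv_left pairing_inv_right)

lemma pairing_self_square:
  assumes "a \<in> carrier H"
  shows "pairing a a ^ 2 = 1"
  using pairing_antisym[OF assms assms] pairing_nonzero[OF assms assms]
  by (metis power2_eq_square right_inverse)

lemma mem_Sp:
  "f \<in> carrier Sp \<longleftrightarrow> f \<in> hom H H \<and> bij_betw f (carrier H) (carrier H) \<and>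
     f \<in> extensional (carrier H) \<and>
     (\<forall>a\<in>carrier H. \<forall>b\<in>carrier H. pairing (f a) (f b) = pairing a b)"
  by (auto simp: Sp_def isometries_def iso_def)

lemma Sp_closed: "\<lbrakk>f \<in> carrier Sp; a \<in> carrier H\<rbrakk> \<Longrightarrow> f a \<in> carrier H"
  by (auto simp: mem_Sp hom_def)

lemma Sp_group_hom: "f \<in> carrier Sp \<Longrightarrow> group_hom H H f"
  by (simp add: mem_Sp group_hom_def group_hom_axioms_def is_group)

lemma Sp_pairing:
  "\<lbrakk>f \<in> carrier Sp; a \<in> carrier H; b \<in> carrier H\<rbrakk> \<Longrightarrow> pairing (f a) (f b) = pairing a b"
  by (simp add: mem_Sp)

lemma Sp_surj: "\<lbrakk>f \<in> carrier Sp; a \<in> carrier H\<rbrakk> \<Longrightarrow> \<exists>b\<in>carrier H. f b = a"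
  by (metis mem_Sp bij_betw_def imageE)

lemma Sp_mult_apply:
  assumes "f \<in> carrier Sp" "g \<in> carrier Sp" "a \<in> carrier H"
  shows "(g \<otimes>\<^bsub>Sp\<^esub> f) a = g (f a)"
proof -
  have "f \<in> Bij (carrier H)" "g \<in> Bij (carrier H)"
    using assms by (auto simp: mem_Sp Bij_def)
  then show ?thesis
    using assms(3) by (simp add: Sp_def BijGroup_def compose_def)
qed

lemma Sp_one: "\<one>\<^bsub>Sp\<^esub> = (\<lambda>a\<in>carrier H. a)"
  by (simp add: Sp_def BijGroup_def)

section \<open>Orthogonal complements and hyperbolic planes\<close>

definition perp :: "'a set \<Rightarrow> 'a set" where
  "perp S = {a \<in> carrier H. \<forall>s\<in>S. pairing s a = 1}"

lemma perp_carrier: "a \<in> perp S \<Longrightarrow> a \<in> carrier H"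
  by (simp add: perp_def)

lemma subgroup_perp:
  assumes "S \<subseteq> carrier H"
  shows "subgroup (perp S) H"
proof (rule subgroupI)
  show "perp S \<noteq> {}"
    using assms pairing_one_right by (auto simp: perp_def)
qed (use assms in \<open>auto simp: perp_def pairing_mult_right pairing_inv_right subset_iff\<close>)

lemma subgroup_pow_closed:
  "\<lbrakk>subgroup T H; a \<in> T\<rbrakk> \<Longrightarrow> a [^] (n::nat) \<in> T"
  by (induction n) (auto simp: subgroup.one_closed subgroup.m_closed)

text \<open>
  For a subgroup \<open>K\<close> of a nonsingular group this says that \<open>H\<close> is the orthogonal direct sum of \<open>K\<close>
  and \<open>perp K\<close>: an element of both would be orthogonal to all of \<open>H\<close>.
\<close>

definition splits :: "'a set \<Rightarrow> bool" where
  "splits K \<longleftrightarrow> K \<subseteq> carrier H \<and> (\<forall>h\<in>carrier H. \<exists>k\<in>K. \<exists>e\<in>perp K. h = k \<otimes> e)"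

definition plane :: "'a \<Rightarrow> 'a \<Rightarrow> 'a set" where
  "plane x y = {x [^] i \<otimes> y [^] j | (i::nat) (j::nat). True}"

lemma plane_carrier: "\<lbrakk>x \<in> carrier H; y \<in> carrier H\<rbrakk> \<Longrightarrow> plane x y \<subseteq> carrier H"
  by (auto simp: plane_def)

lemma in_plane:
  assumes "x \<in> carrier H" "y \<in> carrier H"
  shows "\<one> \<in> plane x y" "x [^] (i::nat) \<in> plane x y" "y \<in> plane x y"
proof -
  show x: "x [^] i \<in> plane x y" for i :: nat
    unfolding plane_def using assms by (intro CollectI exI[of _ i] exI[of _ "0::nat"]) simp
  show "\<one> \<in> plane x y" using x[of 0] by simp
  show "y \<in> plane x y"
    unfolding plane_def using assms by (intro CollectI exI[of _ "0::nat"] exI[of _ "1::nat"]) simp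
qed

lemma perp_plane:
  assumes "x \<in> carrier H" "y \<in> carrier H" "t \<in> carrier H" "pairing x t = 1" "pairing y t = 1"
  shows "t \<in> perp (plane x y)"
  using assms by (auto simp: perp_def plane_def pairing_mult_left pairing_pow_left)

text \<open>
  Gram--Schmidt for the plane spanned by \<open>x\<close> and \<open>y\<close>.  The root of unity \<open>pairing x y\<close> has exact order
  \<open>p ^ Suc n\<close>, so all pairings with \<open>x\<close> and with \<open>y\<close> are powers of it.  Because \<open>y\<close> may have
  \<open>pairing y y = -1\<close>, the order of the corrections matters: a power of \<open>y\<close> first makes the element
  orthogonal to \<open>x\<close>, and a power of \<open>x\<close>, which cannot spoil this since \<open>pairing x x = 1\<close>, then makes it
  orthogonal to \<open>y\<close>.
\<close>

lemma splits_plane: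
  assumes K: "splits K" and x: "x \<in> perp K" and y: "y \<in> perp K"
    and p: "Factorial_Ring.prime p" and xN: "x [^] (p ^ Suc n) = \<one>" and yN: "y [^] (p ^ Suc n) = \<one>"
    and xy: "pairing x y ^ (p ^ n) \<noteq> 1" and xx: "pairing x x = 1"
  shows "splits (K <#> plane x y)"
proof -
  let ?N = "p ^ Suc n"
  have KH: "K \<subseteq> carrier H" using K by (simp add: splits_def)
  have xH: "x \<in> carrier H" and yH: "y \<in> carrier H" using x y by (auto simp: perp_def)
  have N0: "?N > 0" using p by (simp add: prime_gt_0_nat)
  have w1: "pairing x y ^ ?N = 1" "pairing y x ^ ?N = 1"
    using xH yH xN yN by (metis pairing_pow_left pairing_one_left)+
  have yx: "pairing y x ^ (p ^ n) \<noteq> 1"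
    using xy xH yH pairing_antisym[of x y] by (auto simp: power_inverse)
  have "\<exists>k\<in>K <#> plane x y. \<exists>e\<in>perp (K <#> plane x y). h = k \<otimes> e" if h: "h \<in> carrier H" for h
  proof -
    obtain k t where kt: "k \<in> K" "t \<in> perp K" "h = k \<otimes> t"
      using K h by (auto simp: splits_def)
    have tH: "t \<in> carrier H" and kH: "k \<in> carrier H" using kt KH by (auto simp: perp_def)
    have "pairing x t ^ ?N = 1"
      using xH tH xN by (metis pairing_pow_left pairing_one_left)
    then obtain i where i: "pairing x t = pairing x y ^ i"
      using root_of_unity_as_power[OF N0 w1(1) _ prime_power_dvd_exponent[OF p w1(1) xy]] by blast
    define s where "s = t \<otimes> inv (y [^] i)"
    have sH: "s \<in> carrier H" using tH yH by (simp add: s_def)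
    have "pairing x y \<noteq> 0" using pairing_nonzero xH yH by simp
    then have xs: "pairing x s = 1"
      using xH yH tH i by (simp add: s_def pairing_mult_right pairing_inv_right pairing_pow_right)
    have "pairing y s ^ ?N = 1"
      using yH sH yN by (metis pairing_pow_left pairing_one_left)
    then obtain j where j: "pairing y s = pairing y x ^ j"
      using root_of_unity_as_power[OF N0 w1(2) _ prime_power_dvd_exponent[OF p w1(2) yx]] by blast
    define e where "e = s \<otimes> inv (x [^] j)"
    have eH: "e \<in> carrier H" using sH xH by (simp add: e_def)
    have "pairing y x \<noteq> 0" using pairing_nonzero xH yH by simp
    then have ye: "pairing y e = 1"
      using xH yH sH j by (simp add: e_def pairing_mult_right pairing_inv_right pairing_pow_right)
    have xe: "pairing x e = 1"
      using xH sH xs xx by (simp add: e_def pairing_mult_right pairing_inv_right pairing_pow_right)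
    have eK: "e \<in> perp K"
    proof -
      interpret P: subgroup "perp K" H using KH by (rule subgroup_perp)
      show ?thesis
        using kt(2) x y subgroup_pow_closed[OF P.subgroup_axioms] by (simp add: e_def s_def)
    qed
    have eperp: "e \<in> perp (K <#> plane x y)"
      using eK perp_plane[OF xH yH eH xe ye] KH plane_carrier[OF xH yH]
      by (force simp: perp_def set_mult_def pairing_mult_left)
    have "h = (k \<otimes> (x [^] j \<otimes> y [^] i)) \<otimes> e"
    proof -
      have "t = s \<otimes> y [^] i" using tH yH by (simp add: s_def m_assoc)
      moreover have "s = e \<otimes> x [^] j" using sH xH by (simp add: e_def m_assoc)
      ultimately show ?thesis using kt(3) eH xH yH kH by (simp add: m_ac)
    qed
    moreover have "k \<otimes> (x [^] j \<otimes> y [^] i) \<in> K <#> plane x y"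
      using kt(1) by (auto simp: set_mult_def plane_def)
    ultimately show ?thesis using eperp by blast
  qed
  moreover have "K <#> plane x y \<subseteq> carrier H"
    using KH plane_carrier[OF xH yH] by (rule set_mult_closed)
  ultimately show ?thesis by (simp add: splits_def)
qed

definition fixes_set :: "('a \<Rightarrow> 'a) \<Rightarrow> 'a set \<Rightarrow> bool" where
  "fixes_set f K \<longleftrightarrow> (\<forall>k\<in>K. f k = k)"

lemma fixes_plane:
  assumes f: "f \<in> carrier Sp" and "K \<subseteq> carrier H" "x \<in> carrier H" "y \<in> carrier H"
    and fix': "fixes_set f (insert y (insert x K))"
  shows "fixes_set f (K <#> plane x y)"
proof -
  interpret f: group_hom H H f using f by (rule Sp_group_hom)
  show ?thesis
    using assms by (auto simp: fixes_set_def set_mult_def plane_def f.hom_nat_pow subset_iff)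
qed

end

section \<open>Transvections that are isometries\<close>

locale finite_symplectic_group = symplectic_abelian_group +
  assumes finite_carrier: "finite (carrier H)"
    and nonsing: "nonsingular"
begin

lemma nonsingularD:
  assumes "a \<in> carrier H" "\<And>b. b \<in> carrier H \<Longrightarrow> pairing a b = 1"
  shows "a = \<one>"
  using assms nonsing by (auto simp: nonsingular_def)

lemma ord_gt_0: "b \<in> carrier H \<Longrightarrow> ord b > 0"
  using finite_carrier ord_ge_1 by fastforce

definition trans_group :: "('a \<Rightarrow> 'a) set" where
  "trans_group = generate Sp (transvections \<inter> carrier Sp)"

lemma trans_group_subgroup: "subgroup trans_group Sp"
  unfolding trans_group_def using group.generate_is_subgroup[OF group_Sp] by blast

text \<open>
  Write \<open>pairing b a = \<omega> powi i\<close> and \<open>pairing b c = \<omega> powi j\<close>.  In the pairing of the images of \<open>a\<close> and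
  \<open>c\<close>, the two mixed terms are \<open>\<omega> powi (i * j * k)\<close> and its inverse, and the remaining term is a power
  of \<open>pairing b b\<close>.  A map that preserves a nonsingular pairing is injective, hence bijective here.
\<close>

lemma transvection_in_Sp:
  assumes b: "b \<in> carrier H" and bb: "pairing b b = 1"
  shows "transvection b k \<in> carrier Sp"
proof -
  let ?s = "transvection b k"
  have ob: "ord b > 0" using b by (rule ord_gt_0)
  have hom: "?s \<in> hom H H" using b ob by (rule transvection_hom)
  have val: "\<exists>i::int. ?s a = a \<otimes> inv (b [^] (i * k)) \<and> pairing b a = root_of_unity (ord b) powi i"
    if a: "a \<in> carrier H" for a
  proof -
    obtain i :: int where i: "pairing b a = root_of_unity (ord b) powi i"
      using pairing_exponent_exists[OF b a ob] by blast
    then show ?thesis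
      using a b pairing_scale_eq[OF b ob i] by (auto simp: transvection_def int_pow_pow)
  qed
  have pow_left: "pairing (b [^] (i::int)) a = pairing b a powi i" if "a \<in> carrier H" for i a
    using that b
    by (cases i rule: int_cases2)
       (simp_all add: int_pow_int pairing_pow_left int_pow_neg pairing_inv_left power_int_minus)
  have pow_right: "pairing a (b [^] (i::int)) = pairing a b powi i" if "a \<in> carrier H" for i a
    using that b
    by (cases i rule: int_cases2)
       (simp_all add: int_pow_int pairing_pow_right int_pow_neg pairing_inv_right power_int_minus)
  have pres: "pairing (?s a) (?s c) = pairing a c" if a: "a \<in> carrier H" and c: "c \<in> carrier H" for a c
  proof -
    obtain i where i: "?s a = a \<otimes> inv (b [^] (i * k))" "pairing b a = root_of_unity (ord b) powi i"
      using val[OF a] by blast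
    obtain j where j: "?s c = c \<otimes> inv (b [^] (j * k))" "pairing b c = root_of_unity (ord b) powi j"
      using val[OF c] by blast
    have ab: "pairing a b = inverse (root_of_unity (ord b) powi i)"
      using pairing_antisym[OF a b] i(2) by simp
    have "root_of_unity (ord b) \<noteq> 0" by (simp add: root_of_unity_def)
    then show ?thesis
      unfolding i(1) j(1) using a b c ab j(2) bb
      by (simp add: pairing_mult_left pairing_mult_right pairing_inv_left pairing_inv_right
            pow_left pow_right power_int_inverse flip: power_int_mult)
         (simp add: mult_ac)
  qed
  interpret s: group_hom H H ?s
    using hom by (simp add: group_hom_def group_hom_axioms_def is_group)
  have inj: "inj_on ?s (carrier H)"
  proof (rule s.inj_on_one_iff[THEN iffD2], intro allI impI)
    fix a assume a: "a \<in> carrier H" "?s a = \<one>"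
    have "pairing a c = 1" if "c \<in> carrier H" for c
      using pres[OF a(1) that] a(2) s.hom_closed[OF that] by (simp add: pairing_one_left)
    then show "a = \<one>" using a(1) nonsingularD by blast
  qed
  have "bij_betw ?s (carrier H) (carrier H)"
    using endo_inj_surj[OF finite_carrier _ inj] inj s.hom_closed
    by (simp add: bij_betw_def image_subset_iff)
  then show ?thesis
    using hom pres by (simp add: mem_Sp transvection_def)
qed

lemma transvection_fixes:
  assumes "b \<in> carrier H" "a \<in> carrier H" "pairing a b = 1"
  shows "transvection b k a = a"
proof -
  have "pairing b a = root_of_unity (ord b) powi 0"
    using assms pairing_eq_1_sym by simp
  then have "pairing_scale b a = \<one>"
    using pairing_scale_eq[OF assms(1) ord_gt_0[OF assms(1)]] by (metis int_pow_0)
  then show ?thesis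
    using assms by (simp add: transvection_def)
qed

text \<open>
  The hypotheses say that \<open>w = pairing b z\<close> has the same order as \<open>b\<close>.  Hence the standard root of
  unity \<open>\<omega>\<close> is a power \<open>w ^ i\<close>, and \<open>i\<close> inverts the exponent \<open>j\<close> of \<open>w = \<omega> powi j\<close> modulo this
  order.  With the factor \<open>k = i\<close> the transvection therefore subtracts exactly \<open>b\<close> from \<open>z\<close>.
\<close>

lemma shift_by_transvection:
  assumes b: "b \<in> carrier H" and z: "z \<in> carrier H" and bb: "pairing b b = 1"
    and p: "Factorial_Ring.prime p" and bN: "b [^] (p ^ Suc n) = \<one>" and bz: "pairing b z ^ (p ^ n) \<noteq> 1"
  shows "\<exists>s\<in>trans_group. s z = z \<otimes> inv b \<and> (\<forall>a\<in>carrier H. pairing a b = 1 \<longrightarrow> s a = a)"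
proof -
  let ?w = "pairing b z"
  have ob: "ord b > 0" using b by (rule ord_gt_0)
  have w1: "?w ^ (p ^ Suc n) = 1"
    using b z bN by (metis pairing_pow_left pairing_one_left)
  have wo: "?w ^ ord b = 1"
    using b z by (metis pairing_pow_left pairing_one_left pow_ord_eq_1)
  have prim: "ord b dvd m" if "?w ^ m = 1" for m
    using prime_power_dvd_exponent[OF p w1 bz that] pow_eq_id[OF b] bN dvd_trans by blast
  have ro: "root_of_unity (ord b) ^ ord b = 1"
    using root_of_unity_powi_eq_1_iff[OF ob, of "int (ord b)"] by simp
  obtain i where i: "root_of_unity (ord b) = ?w ^ i"
    using root_of_unity_as_power[OF ob wo ro prim] by blast
  obtain j :: int where j: "?w = root_of_unity (ord b) powi j"
    using pairing_exponent_exists[OF b z ob] by blast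
  have "root_of_unity (ord b) powi (j * int i) = root_of_unity (ord b) powi 1"
    using i j by (simp add: power_int_mult)
  then have "int (ord b) dvd j * int i - 1"
    using root_of_unity_powi_eq_iff[OF ob] by blast
  then have "b [^] (j * int i) = b [^] (1::int)"
    using b by (metis int_pow_eq dvd_diff_commute)
  then have "pairing_scale b z [^] int i = b"
    using pairing_scale_eq[OF b ob j] b by (simp add: int_pow_pow)
  then have sz: "transvection b (int i) z = z \<otimes> inv b"
    using z by (simp add: transvection_def)
  have "b \<noteq> \<one>" using bz z by (auto simp: pairing_one_left)
  then have "transvection b (int i) \<in> transvections \<inter> carrier Sp"
    using b transvection_in_Sp[OF b bb] by (auto simp: transvections_def)
  then have "transvection b (int i) \<in> trans_group"
    unfolding trans_group_def by (rule generate.incl)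
  then show ?thesis
    using sz transvection_fixes b by blast
qed

section \<open>Making an isometry fix further elements\<close>

text \<open>
  With \<open>d = f a \<otimes> inv a\<close>, either a shift along \<open>d\<close> brings \<open>f a\<close> back to \<open>a\<close>, or \<open>pairing d a\<close> has
  too small an order.  In the latter case \<open>pairing (d \<otimes> inv u) (f a)\<close> has the same (full) order as
  \<open>pairing u (f a)\<close>, so a shift along \<open>d \<otimes> inv u\<close> brings \<open>f a\<close> to \<open>a \<otimes> u\<close> and a shift along \<open>u\<close>
  brings this to \<open>a\<close>.  All these directions are orthogonal to \<open>K\<close>, so \<open>K\<close> stays fixed.
\<close>

lemma fix_one_more:
  assumes f: "f \<in> carrier Sp" and a: "a \<in> carrier H" and KH: "K \<subseteq> carrier H"
    and fK: "fixes_set f K" and p: "Factorial_Ring.prime p"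
    and dN: "(f a \<otimes> inv a) [^] (p ^ Suc n) = \<one>"
    and u: "u \<in> perp K" and uu: "pairing u u = 1" and uN: "u [^] (p ^ Suc n) = \<one>"
    and ua: "pairing u a ^ (p ^ n) \<noteq> 1" and ufa: "pairing u (f a) ^ (p ^ n) \<noteq> 1"
  shows "\<exists>g\<in>trans_group. fixes_set (g \<otimes>\<^bsub>Sp\<^esub> f) (insert a K)"
proof -
  interpret T: subgroup trans_group Sp by (rule trans_group_subgroup)
  define d where "d = f a \<otimes> inv a"
  have fa: "f a \<in> carrier H" using f a by (rule Sp_closed)
  have dH: "d \<in> carrier H" using a fa by (simp add: d_def)
  have uH: "u \<in> carrier H" using u by (rule perp_carrier)
  have fad: "f a = a \<otimes> d" using a fa m_lcomm[of a "f a" "inv a"] by (simp add: d_def)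
  have dd: "pairing d d = 1"
    using a fa Sp_pairing[OF f a a] pairing_self_square[OF a]
    by (simp add: d_def pairing_self_mult pairing_self_inv power2_eq_square)
  have dK: "pairing k d = 1" if "k \<in> K" for k
  proof -
    have k: "k \<in> carrier H" "f k = k" using that KH fK by (auto simp: fixes_set_def)
    have "pairing k (f a) = pairing k a" using Sp_pairing[OF f k(1) a] k by simp
    then show ?thesis
      using k a fa pairing_nonzero[of k a] by (simp add: d_def pairing_mult_right pairing_inv_right)
  qed
  have fin: ?thesis if "g \<in> trans_group" "g (f a) = a" "\<And>k. k \<in> K \<Longrightarrow> g k = k" for g
  proof (intro bexI[of _ g])
    show "fixes_set (g \<otimes>\<^bsub>Sp\<^esub> f) (insert a K)"
      using that f a KH fK T.mem_carrier[OF that(1)]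
      by (auto simp: fixes_set_def Sp_mult_apply subset_iff)
  qed fact
  have dfa: "pairing d (f a) = pairing d a"
    using dH a dd by (simp add: fad pairing_mult_right)
  show ?thesis
  proof (cases "pairing d a ^ (p ^ n) = 1")
    case False
    obtain s where s: "s \<in> trans_group" "s (f a) = f a \<otimes> inv d"
        "\<forall>k\<in>carrier H. pairing k d = 1 \<longrightarrow> s k = k"
      using shift_by_transvection[OF dH fa dd p, of n] dN False dfa d_def by auto
    have "f a \<otimes> inv d = a" using a dH by (simp add: fad m_assoc)
    then show ?thesis using fin[of s] s dK KH by (auto simp: subset_iff)
  next
    case True
    define b where "b = d \<otimes> inv u"
    have bH: "b \<in> carrier H" using dH uH by (simp add: b_def)
    have bb: "pairing b b = 1"
      using dH uH dd uu by (simp add: b_def pairing_self_mult pairing_self_inv)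
    have bN: "b [^] (p ^ Suc n) = \<one>"
      using dH uH dN uN by (simp add: b_def d_def[symmetric] nat_pow_distrib nat_pow_inv)
    have "pairing b (f a) ^ (p ^ n) = inverse (pairing u (f a) ^ (p ^ n))"
      using dH uH fa True
      by (simp add: b_def pairing_mult_left pairing_inv_left power_mult_distrib dfa power_inverse)
    then have bfa: "pairing b (f a) ^ (p ^ n) \<noteq> 1"
      using ufa by auto
    obtain s where s: "s \<in> trans_group" "s (f a) = f a \<otimes> inv b"
        "\<forall>k\<in>carrier H. pairing k b = 1 \<longrightarrow> s k = k"
      using shift_by_transvection[OF bH fa bb p bN bfa] by blast
    have au: "f a \<otimes> inv b = a \<otimes> u"
    proof -
      have "inv b = inv d \<otimes> u" using dH uH by (simp add: b_def inv_mult)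
      then show ?thesis using a dH uH by (simp add: fad m_assoc[symmetric]) (simp add: m_assoc)
    qed
    have "pairing u (a \<otimes> u) ^ (p ^ n) \<noteq> 1"
      using ua a uH uu by (simp add: pairing_mult_right)
    then obtain t where t: "t \<in> trans_group" "t (a \<otimes> u) = (a \<otimes> u) \<otimes> inv u"
        "\<forall>k\<in>carrier H. pairing k u = 1 \<longrightarrow> t k = k"
      using shift_by_transvection[OF uH _ uu p uN] a uH by blast
    have bK: "pairing k b = 1" "pairing k u = 1" if "k \<in> K" for k
      using that dK[OF that] u uH dH KH
      by (auto simp: b_def perp_def pairing_mult_right pairing_inv_right subset_iff)
    have st: "s \<in> carrier Sp" "t \<in> carrier Sp" using s(1) t(1) T.mem_carrier by auto
    show ?thesis
    proof (rule fin)
      show "t \<otimes>\<^bsub>Sp\<^esub> s \<in> trans_group" using t(1) s(1) by (rule T.m_closed)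
      show "(t \<otimes>\<^bsub>Sp\<^esub> s) (f a) = a"
        using st fa s(2) au t(2) a uH by (simp add: Sp_mult_apply m_assoc)
      show "(t \<otimes>\<^bsub>Sp\<^esub> s) k = k" if "k \<in> K" for k
        using that KH st bK[OF that] s(3) t(3) by (auto simp: Sp_mult_apply subset_iff)
    qed
  qed
qed

lemma in_trans_group_if_mult:
  assumes "f \<in> carrier Sp" "g \<in> trans_group" "g \<otimes>\<^bsub>Sp\<^esub> f \<in> trans_group"
  shows "f \<in> trans_group"
proof -
  interpret S: group Sp by (rule group_Sp)
  interpret T: subgroup trans_group Sp by (rule trans_group_subgroup)
  have "inv\<^bsub>Sp\<^esub> g \<otimes>\<^bsub>Sp\<^esub> (g \<otimes>\<^bsub>Sp\<^esub> f) = f"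
    using assms T.mem_carrier by (simp add: S.m_assoc[symmetric])
  then show ?thesis using assms T.m_closed T.m_inv_closed by metis
qed

text \<open>
  Once \<open>x\<close> is fixed, \<open>x\<close> itself serves as the detour direction for its partner \<open>y\<close>: it is orthogonal
  to \<open>x\<close> and to \<open>K\<close>, and \<open>pairing x (f y) = pairing (f x) (f y) = pairing x y\<close> has full order.
\<close>

lemma fix_plane:
  assumes f: "f \<in> carrier Sp" and KH: "K \<subseteq> carrier H" and fK: "fixes_set f (insert x K)"
    and x: "x \<in> perp K" and y: "y \<in> perp K" and p: "Factorial_Ring.prime p"
    and xN: "x [^] (p ^ Suc n) = \<one>" and yN: "y [^] (p ^ Suc n) = \<one>"
    and xy: "pairing x y ^ (p ^ n) \<noteq> 1" and xx: "pairing x x = 1"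
  shows "\<exists>g\<in>trans_group. fixes_set (g \<otimes>\<^bsub>Sp\<^esub> f) (K <#> plane x y)"
proof -
  interpret f: group_hom H H f using f by (rule Sp_group_hom)
  interpret S: group Sp by (rule group_Sp)
  interpret T: subgroup trans_group Sp by (rule trans_group_subgroup)
  have xH: "x \<in> carrier H" and yH: "y \<in> carrier H" using x y by (auto simp: perp_def)
  have fx: "f x = x" using fK by (simp add: fixes_set_def)
  have dN: "(f y \<otimes> inv y) [^] (p ^ Suc n) = \<one>"
    using yH yN by (simp add: nat_pow_distrib nat_pow_inv f.hom_nat_pow[symmetric])
  have xfy: "pairing x (f y) = pairing x y"
    using Sp_pairing[OF f xH yH] fx by simp
  have xp: "x \<in> perp (insert x K)"
    using x xx by (simp add: perp_def)
  obtain g where g: "g \<in> trans_group" "fixes_set (g \<otimes>\<^bsub>Sp\<^esub> f) (insert y (insert x K))"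
    using fix_one_more[OF f yH _ fK p dN xp xx xN] xH KH xy xfy by auto
  have "g \<otimes>\<^bsub>Sp\<^esub> f \<in> carrier Sp" using g(1) f T.mem_carrier by simp
  then have "fixes_set (g \<otimes>\<^bsub>Sp\<^esub> f) (K <#> plane x y)"
    using fixes_plane[OF _ KH xH yH g(2)] by simp
  then show ?thesis using g(1) by blast
qed

section \<open>Induction on the complement\<close>

text \<open>
  Choose a prime \<open>p\<close> for which \<open>perp K\<close> has nontrivial \<open>p\<close>-elements, and let \<open>p ^ Suc n\<close> be the
  exponent of its \<open>p\<close>-part.  An element \<open>x\<close> of the \<open>p\<close>-part that attains this exponent has, by
  nonsingularity and the splitting, a partner in \<open>perp K\<close>; its \<open>p\<close>-component \<open>y\<close> is still a partner,
  and the order of \<open>y\<close> is bounded by the exponent.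
\<close>

lemma hyperbolic_pair_exists:
  assumes K: "splits K" and nt: "\<not> perp K \<subseteq> {\<one>}"
  shows "\<exists>(p::nat) n x y. Factorial_Ring.prime p \<and> x \<in> perp K \<and> y \<in> perp K \<and>
    x [^] (p ^ Suc n) = \<one> \<and> y [^] (p ^ Suc n) = \<one> \<and> pairing x y ^ (p ^ n) \<noteq> 1"
proof -
  have KH: "K \<subseteq> carrier H" using K by (simp add: splits_def)
  have P: "subgroup (perp K) H" using KH by (rule subgroup_perp)
  obtain e0 where e0: "e0 \<in> perp K" "e0 \<noteq> \<one>" using nt by blast
  have e0H: "e0 \<in> carrier H" using e0 by (simp add: perp_def)
  have "ord e0 \<noteq> 1" using e0(2) ord_eq_1[OF e0H] by simp
  then obtain p where p: "Factorial_Ring.prime p" "p dvd ord e0"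
    using prime_factor_nat by blast
  have H0: "card (carrier H) > 0"
    using finite_carrier one_closed by (auto simp: card_gt_0_iff)
  define r where "r = multiplicity p (card (carrier H))"
  have "card (carrier H) \<noteq> 0" "\<not> is_unit p" using H0 p(1) by (auto simp: prime_nat_iff)
  then obtain m where rm: "card (carrier H) = p ^ r * m" "\<not> p dvd m"
    unfolding r_def by (rule multiplicity_decompose')
  have kill: "(e [^] m) [^] (p ^ r) = \<one>" if "e \<in> perp K" for e
    using perp_carrier[OF that] pow_order_eq_1[of e]
    by (simp add: nat_pow_pow order_def rm(1) mult.commute)
  \<comment> \<open>Raising to the power \<open>m\<close>, the part of the group order prime to \<open>p\<close>, projects into the
     \<open>p\<close>-part.  The number \<open>n\<close> is found as the last one for which \<open>Q\<close> fails.\<close>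
  define Q where "Q = (\<lambda>k. \<forall>e\<in>perp K. (e [^] m) [^] (p ^ k) = \<one>)"
  have Qr: "Q r" using kill by (simp add: Q_def)
  have nQ0: "\<not> Q 0"
  proof
    assume "Q 0"
    then have "(e0 [^] m) [^] (1::nat) = \<one>" using e0(1) by (auto simp: Q_def)
    then have "ord e0 dvd m" using e0H by (simp add: pow_eq_id)
    then show False using p(2) rm(2) dvd_trans by blast
  qed
  obtain n where n: "\<not> Q n" "Q (Suc n)"
    using Qr nQ0 by (induction r) blast+
  obtain e where e: "e \<in> perp K" "(e [^] m) [^] (p ^ n) \<noteq> \<one>" using n(1) by (auto simp: Q_def)
  define x where "x = e [^] m"
  have x: "x \<in> perp K" using subgroup_pow_closed[OF P e(1)] by (simp add: x_def)
  have xN: "x [^] (p ^ Suc n) = \<one>" using n(2) e(1) unfolding Q_def x_def by blast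
  have xH: "x \<in> carrier H" using x by (rule perp_carrier)
  \<comment> \<open>Pairing with \<open>x'\<close>, of order \<open>p\<close>, detects whether a pairing with \<open>x\<close> has full order.\<close>
  define x' where "x' = x [^] (p ^ n)"
  have x'H: "x' \<in> carrier H" using xH by (simp add: x'_def)
  have x'K: "x' \<in> perp K" using subgroup_pow_closed[OF P x] by (simp add: x'_def)
  have x'p: "x' [^] p = \<one>"
    using xN xH by (simp add: x'_def nat_pow_pow mult.commute)
  have "x' \<noteq> \<one>" using e(2) by (simp add: x'_def x_def)
  then obtain z where z: "z \<in> carrier H" "pairing x' z \<noteq> 1" using nonsingularD[OF x'H] by blast
  obtain k t where kt: "k \<in> K" "t \<in> perp K" "z = k \<otimes> t" using K z(1) by (auto simp: splits_def)
  have tH: "t \<in> carrier H" and kH: "k \<in> carrier H" using kt KH by (auto simp: perp_def)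
  have "pairing k x' = 1" using x'K kt(1) by (simp add: perp_def)
  then have "pairing x' k = 1" using pairing_eq_1_sym x'H kH by blast
  then have x't: "pairing x' t \<noteq> 1" using z(2) kt(3) x'H kH tH by (simp add: pairing_mult_right)
  define y where "y = t [^] m"
  have y: "y \<in> perp K" using subgroup_pow_closed[OF P kt(2)] by (simp add: y_def)
  have yN: "y [^] (p ^ Suc n) = \<one>" using n(2) kt(2) unfolding Q_def y_def by blast
  have yH: "y \<in> carrier H" using y by (rule perp_carrier)
  have "pairing x y ^ (p ^ n) = pairing x' t ^ m"
    using xH tH by (simp add: x'_def y_def pairing_pow_left pairing_pow_right mult.commute flip: power_mult)
  also have "\<dots> \<noteq> 1"
  proof
    assume "pairing x' t ^ m = 1"
    moreover have "pairing x' t ^ (p ^ Suc 0) = 1"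
      using x'H tH x'p by (simp add: pairing_one_left flip: pairing_pow_left)
    ultimately have "p ^ Suc 0 dvd m"
      using prime_power_dvd_exponent[OF p(1), of "pairing x' t" 0 m] x't by simp
    then show False using rm(2) by simp
  qed
  finally show ?thesis using p(1) x y xN yN by blast
qed

text \<open>
  A hyperbolic pair \<open>x, y\<close> of \<open>perp K\<close> is fixed and absorbed into \<open>K\<close>.  To fix \<open>x\<close>, the detour
  direction must have full-order pairings with both \<open>x\<close> and \<open>f x\<close>.  Since \<open>y\<close> is a partner of \<open>x\<close>
  and \<open>f y\<close> one of \<open>f x\<close>, one of \<open>y\<close>, \<open>f y\<close> and \<open>y \<otimes> f y\<close> is such a direction.
\<close>

lemma trans_group_if_fixes:
  assumes "f \<in> carrier Sp" "splits K" "\<And>a. a \<in> perp K \<Longrightarrow> pairing a a = 1" "fixes_set f K"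
  shows "f \<in> trans_group"
  using assms
proof (induction "card (perp K)" arbitrary: f K rule: less_induct)
  case less
  note f = less.prems(1) and K = less.prems(2) and q = less.prems(3) and fK = less.prems(4)
  interpret S: group Sp by (rule group_Sp)
  interpret T: subgroup trans_group Sp by (rule trans_group_subgroup)
  interpret f: group_hom H H f using f by (rule Sp_group_hom)
  have KH: "K \<subseteq> carrier H" using K by (simp add: splits_def)
  have P: "subgroup (perp K) H" using KH by (rule subgroup_perp)
  show ?case
  proof (cases "perp K \<subseteq> {\<one>}")
    case True
    have "f a = a" if a: "a \<in> carrier H" for a
    proof -
      obtain k e where "k \<in> K" "e \<in> perp K" "a = k \<otimes> e" using K a by (auto simp: splits_def)
      moreover from this have "e = \<one>" "k \<in> carrier H" "f k = k"
        using True KH fK unfolding fixes_set_def by blast+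
      ultimately show ?thesis by simp
    qed
    moreover have "f \<in> extensional (carrier H)" using f unfolding mem_Sp by blast
    ultimately have "f = \<one>\<^bsub>Sp\<^esub>"
      unfolding Sp_one by (intro extensionalityI[of f "carrier H"]) simp_all
    then show ?thesis by simp
  next
    case False
    obtain p n x y where p: "Factorial_Ring.prime p" and x: "x \<in> perp K" and y: "y \<in> perp K"
      and xN: "x [^] (p ^ Suc n) = \<one>" and yN: "y [^] (p ^ Suc n) = \<one>"
      and xy: "pairing x y ^ (p ^ n) \<noteq> 1"
      using hyperbolic_pair_exists[OF K False] by blast
    have xH: "x \<in> carrier H" and yH: "y \<in> carrier H" using x y by (auto simp: perp_def)
    have xx: "pairing x x = 1" using q x by simp
    have fxH: "f x \<in> carrier H" and fyH: "f y \<in> carrier H" using xH yH by auto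
    have fy: "f y \<in> perp K"
      unfolding perp_def
    proof (intro CollectI conjI ballI fyH)
      fix k assume "k \<in> K"
      then show "pairing k (f y) = 1"
        using Sp_pairing[OF f _ yH, of k] fK KH y by (auto simp: fixes_set_def perp_def)
    qed
    have fyN: "f y [^] (p ^ Suc n) = \<one>"
      using yH yN by (metis f.hom_nat_pow f.hom_one)
    have fxN: "f x [^] (p ^ Suc n) = \<one>"
      using xH xN by (metis f.hom_nat_pow f.hom_one)
    have dN: "(f x \<otimes> inv x) [^] (p ^ Suc n) = \<one>"
      using xH fxH xN fxN by (simp add: nat_pow_distrib nat_pow_inv)
    have yx: "pairing y x ^ (p ^ n) \<noteq> 1"
      using xy xH yH pairing_antisym[of x y] by (auto simp: power_inverse)
    have fyfx: "pairing (f y) (f x) ^ (p ^ n) \<noteq> 1"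
      using yx Sp_pairing[OF f yH xH] by simp
    obtain u where u: "u \<in> perp K" "u [^] (p ^ Suc n) = \<one>"
        "pairing u x ^ (p ^ n) \<noteq> 1" "pairing u (f x) ^ (p ^ n) \<noteq> 1"
    proof (cases "pairing y (f x) ^ (p ^ n) = 1")
      case False
      then show ?thesis using that[of y] y yN yx by blast
    next
      case yfx: True
      show ?thesis
      proof (cases "pairing (f y) x ^ (p ^ n) = 1")
        case False
        then show ?thesis using that[of "f y"] fy fyN fyfx by blast
      next
        case True
        show ?thesis
        proof (rule that)
          show "y \<otimes> f y \<in> perp K" using P y fy by (rule subgroup.m_closed)
          show "(y \<otimes> f y) [^] (p ^ Suc n) = \<one>"
            using yH fyH yN fyN by (simp add: nat_pow_distrib)
          show "pairing (y \<otimes> f y) x ^ (p ^ n) \<noteq> 1" "pairing (y \<otimes> f y) (f x) ^ (p ^ n) \<noteq> 1"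
            using xH yH fxH fyH True yfx yx fyfx by (simp_all add: pairing_mult_left power_mult_distrib)
        qed
      qed
    qed
    obtain g where g: "g \<in> trans_group" "fixes_set (g \<otimes>\<^bsub>Sp\<^esub> f) (insert x K)"
      using fix_one_more[OF f xH KH fK p dN u(1) q[OF u(1)] u(2-4)] by blast
    have gf: "g \<otimes>\<^bsub>Sp\<^esub> f \<in> carrier Sp" using g(1) f T.mem_carrier by simp
    obtain g' where g': "g' \<in> trans_group"
        "fixes_set (g' \<otimes>\<^bsub>Sp\<^esub> (g \<otimes>\<^bsub>Sp\<^esub> f)) (K <#> plane x y)"
      using fix_plane[OF gf KH g(2) x y p xN yN xy xx] by blast
    let ?K' = "K <#> plane x y"
    have sub: "perp ?K' \<subseteq> perp K"
    proof -
      have "K \<subseteq> ?K'"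
        using in_plane(1)[OF xH yH] KH by (force simp: set_mult_def)
      then show ?thesis by (auto simp: perp_def)
    qed
    have "x \<notin> perp ?K'"
    proof
      assume x': "x \<in> perp ?K'"
      obtain k e where k: "k \<in> K" "e \<in> perp K" "\<one> = k \<otimes> e"
        using K one_closed unfolding splits_def by blast
      have "k \<otimes> y \<in> ?K'" using k in_plane(3)[OF xH yH] by (auto simp: set_mult_def)
      then have "pairing (k \<otimes> y) x = 1" using x' by (simp add: perp_def)
      moreover have "pairing k x = 1" using k x by (simp add: perp_def)
      ultimately have "pairing y x = 1" using k KH xH yH by (auto simp: pairing_mult_left)
      then show False using yx by simp
    qed
    then have "perp ?K' \<subset> perp K" using sub x by auto
    moreover have "finite (perp K)"
      using finite_carrier by (rule finite_subset[rotated]) (auto simp: perp_def)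
    ultimately have "card (perp ?K') < card (perp K)" by (rule psubset_card_mono[rotated])
    moreover have "g' \<otimes>\<^bsub>Sp\<^esub> (g \<otimes>\<^bsub>Sp\<^esub> f) \<in> carrier Sp"
      using gf g'(1) T.mem_carrier by simp
    moreover have "splits ?K'" using splits_plane[OF K x y p xN yN xy xx] .
    ultimately have "g' \<otimes>\<^bsub>Sp\<^esub> (g \<otimes>\<^bsub>Sp\<^esub> f) \<in> trans_group"
      using less.hyps[of ?K'] q sub g'(2) by blast
    then have "g \<otimes>\<^bsub>Sp\<^esub> f \<in> trans_group" using in_trans_group_if_mult[OF gf g'(1)] by blast
    then show ?thesis using in_trans_group_if_mult[OF f g(1)] by blast
  qed
qed

section \<open>Duality between subgroups and their complements\<close>

lemma sum_pairing_subgroup: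
  assumes T: "subgroup T H" and a: "a \<in> carrier H"
  shows "(\<Sum>t\<in>T. pairing t a) = (if a \<in> perp T then of_nat (card T) else 0)"
proof (cases "a \<in> perp T")
  case True
  then show ?thesis by (simp add: perp_def)
next
  case False
  interpret T: subgroup T H by (rule T)
  obtain s where s: "s \<in> T" "pairing s a \<noteq> 1" using False a by (auto simp: perp_def)
  have "bij_betw (\<lambda>t. s \<otimes> t) T T"
    by (rule bij_betw_byWitness[where f' = "\<lambda>t. inv s \<otimes> t"])
       (use s in \<open>auto simp: m_assoc[symmetric]\<close>)
  then have "(\<Sum>t\<in>T. pairing t a) = (\<Sum>t\<in>T. pairing (s \<otimes> t) a)"
    by (rule sum.reindex_bij_betw[symmetric])
  also have "\<dots> = pairing s a * (\<Sum>t\<in>T. pairing t a)"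
    using s a by (simp add: pairing_mult_left sum_distrib_left)
  finally have "(\<Sum>t\<in>T. pairing t a) = 0"
    using s(2) by (metis mult_cancel_right1)
  then show ?thesis using False by simp
qed

text \<open>
  Sum \<open>pairing t a\<close> over all \<open>t \<in> T\<close> and \<open>a \<in> carrier H\<close> in both orders: a nontrivial character of a
  finite group sums to zero, so one order counts \<open>perp T\<close> and the other, by nonsingularity, only sees
  \<open>t = \<one>\<close>.
\<close>

lemma card_perp:
  assumes T: "subgroup T H"
  shows "card T * card (perp T) = card (carrier H)"
proof -
  interpret T: subgroup T H by (rule T)
  have perpH: "t \<in> perp (carrier H) \<longleftrightarrow> t = \<one>" if "t \<in> carrier H" for t
    using that nonsingularD[of t] pairing_eq_1_sym by (auto simp: perp_def pairing_one_right)
  have fT: "finite T" using finite_carrier T.subset finite_subset by blast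
  have "(\<Sum>a\<in>carrier H. \<Sum>t\<in>T. pairing t a) = (\<Sum>a\<in>carrier H. if a \<in> perp T then of_nat (card T) else 0)"
    using sum_pairing_subgroup[OF T] by simp
  also have "\<dots> = (\<Sum>a\<in>perp T. of_nat (card T))"
    by (rule sum.mono_neutral_cong_right) (use finite_carrier in \<open>auto simp: perp_def\<close>)
  finally have 1: "(\<Sum>a\<in>carrier H. \<Sum>t\<in>T. pairing t a) = of_nat (card T * card (perp T))"
    by simp
  have "(\<Sum>a\<in>carrier H. \<Sum>t\<in>T. pairing t a) = (\<Sum>t\<in>T. \<Sum>a\<in>carrier H. inverse (pairing a t))"
    by (subst sum.swap) (intro sum.cong refl pairing_antisym; simp)
  also have "\<dots> = (\<Sum>t\<in>T. \<Sum>a\<in>carrier H. pairing a t)"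
  proof (rule sum.cong[OF refl])
    fix t assume t: "t \<in> T"
    have "(\<Sum>a\<in>carrier H. inverse (pairing a t)) = (\<Sum>a\<in>carrier H. pairing (inv a) t)"
      using t by (simp add: pairing_inv_left)
    also have "\<dots> = (\<Sum>a\<in>carrier H. pairing a t)"
      by (rule sum.reindex_bij_betw, rule bij_betw_byWitness[where f' = "\<lambda>a. inv a"]) auto
    finally show "(\<Sum>a\<in>carrier H. inverse (pairing a t)) = (\<Sum>a\<in>carrier H. pairing a t)" .
  qed
  also have "\<dots> = (\<Sum>t\<in>T. if t = \<one> then of_nat (card (carrier H)) else 0)"
    using sum_pairing_subgroup[OF subgroup_self] perpH by (intro sum.cong refl) simp
  also have "\<dots> = of_nat (card (carrier H))" using fT by simp
  finally show ?thesis using 1 by (metis of_nat_eq_iff)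
qed

lemma perp_perp:
  assumes T: "subgroup T H"
  shows "perp (perp T) = T"
proof -
  interpret T: subgroup T H by (rule T)
  have P: "subgroup (perp T) H" using T.subset by (rule subgroup_perp)
  have "card (perp T) \<noteq> 0"
    using card_perp[OF T] finite_carrier by (metis card_0_eq carrier_not_empty mult_0_right)
  then have "card (perp (perp T)) = card T"
    using card_perp[OF T] card_perp[OF P] by (metis mult.commute mult_cancel1)
  moreover have "T \<subseteq> perp (perp T)"
    using pairing_eq_1_sym T.subset by (auto simp: perp_def subset_iff)
  moreover have "finite (perp (perp T))"
    using finite_carrier by (rule finite_subset[rotated]) (auto simp: perp_def)
  ultimately show ?thesis by (metis card_subset_eq)
qed

section \<open>The element representing the self-pairing\<close>

text \<open>
  If \<open>pairing a a\<close> is not constantly 1, then \<open>T = {a. pairing a a = 1}\<close> has index 2, and any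
  \<open>c \<noteq> \<one>\<close> orthogonal to \<open>T\<close> induces the only nontrivial character that is trivial on \<open>T\<close>.
\<close>

lemma pairing_self_represented:
  obtains c where "c \<in> carrier H" "\<And>a. a \<in> carrier H \<Longrightarrow> pairing a a = pairing c a"
proof -
  define T where "T = {a \<in> carrier H. pairing a a = 1}"
  have T: "subgroup T H"
  proof (rule subgroupI)
    show "T \<noteq> {}" using pairing_one_left by (auto simp: T_def)
  qed (auto simp: T_def pairing_self_mult pairing_self_inv)
  show ?thesis
  proof (cases "T = carrier H")
    case True
    then show ?thesis using that[of \<one>] by (auto simp: T_def pairing_one_left)
  next
    case False
    have "\<not> perp T \<subseteq> {\<one>}"
    proof
      assume "perp T \<subseteq> {\<one>}"
      then have "carrier H \<subseteq> perp (perp T)"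
        by (auto simp: perp_def subset_iff pairing_one_left)
      then show False using perp_perp[OF T] False subgroup.subset[OF T] by auto
    qed
    then obtain c where c: "c \<in> perp T" "c \<noteq> \<one>" by blast
    have cH: "c \<in> carrier H" using c by (simp add: perp_def)
    have cT: "pairing c t = 1" if "t \<in> T" for t
      using c(1) that pairing_eq_1_sym[OF cH, of t] subgroup.subset[OF T] by (auto simp: perp_def)
    have m1: "pairing a a = -1" if "a \<in> carrier H" "a \<notin> T" for a
      using that pairing_self_square[of a] by (auto simp: T_def power2_eq_1_iff)
    have "pairing a a = pairing c a" if a: "a \<in> carrier H" for a
    proof (cases "a \<in> T")
      case True
      then show ?thesis using cT by (simp add: T_def)
    next
      case aT: False
      have "pairing c a \<noteq> 1"
      proof
        assume ca: "pairing c a = 1"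
        have "pairing c b = 1" if b: "b \<in> carrier H" for b
        proof (cases "b \<in> T")
          case False
          then have "b \<otimes> inv a \<in> T"
            using a b m1[OF b] m1[OF a aT] by (simp add: T_def pairing_self_mult pairing_self_inv)
          then have "pairing c (b \<otimes> inv a) = 1" by (rule cT)
          then show ?thesis using a b cH ca by (simp add: pairing_mult_right pairing_inv_right)
        qed (rule cT)
        then show False using nonsingularD[OF cH] c(2) by blast
      qed
      moreover have "a \<otimes> a \<in> T"
        using a m1[OF a aT] by (simp add: T_def pairing_self_mult)
      then have "pairing c a ^ 2 = 1"
        using cT[of "a \<otimes> a"] cH a by (simp add: pairing_mult_right power2_eq_square)
      ultimately have "pairing c a = -1" by (auto simp: power2_eq_1_iff)
      then show ?thesis using m1 a aT by simp
    qed
    then show ?thesis using that cH by blast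
  qed
qed

text \<open>
  The \<open>N\<close>-th powers form a subgroup whose complement consists of the elements killed by \<open>N\<close>.  By
  \<open>perp_perp\<close>, an element orthogonal to all of the latter would be an \<open>N\<close>-th power.
\<close>

lemma power_free_partner:
  assumes c: "c \<in> carrier H" and nc: "\<And>a. a \<in> carrier H \<Longrightarrow> a [^] (N::nat) \<noteq> c"
  shows "\<exists>y\<in>carrier H. y [^] N = \<one> \<and> pairing y c \<noteq> 1"
proof -
  define T where "T = (\<lambda>a. a [^] N) ` carrier H"
  have T: "subgroup T H"
  proof (rule subgroupI)
    show "inv a \<in> T" if "a \<in> T" for a
    proof -
      obtain b where "b \<in> carrier H" "a = b [^] N" using \<open>a \<in> T\<close> by (auto simp: T_def)
      then show ?thesis unfolding T_def by (intro image_eqI[of _ _ "inv b"]) (auto simp: nat_pow_inv)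
    qed
    show "a \<otimes> b \<in> T" if "a \<in> T" "b \<in> T" for a b
    proof -
      obtain a' b' where "a' \<in> carrier H" "a = a' [^] N" "b' \<in> carrier H" "b = b' [^] N"
        using \<open>a \<in> T\<close> \<open>b \<in> T\<close> by (auto simp: T_def)
      then show ?thesis
        unfolding T_def by (intro image_eqI[of _ _ "a' \<otimes> b'"]) (auto simp: nat_pow_distrib)
    qed
  qed (auto simp: T_def)
  have "c \<notin> perp (perp T)" using perp_perp[OF T] nc by (auto simp: T_def)
  then obtain y where y: "y \<in> perp T" "pairing y c \<noteq> 1" using c by (auto simp: perp_def)
  have yH: "y \<in> carrier H" using y by (simp add: perp_def)
  have "y [^] N = \<one>"
  proof (rule nonsingularD)
    fix b assume b: "b \<in> carrier H"
    have "pairing (b [^] N) y = 1" using y(1) b by (auto simp: perp_def T_def)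
    then have "pairing b y ^ N = 1" using b yH by (simp add: pairing_pow_left)
    then show "pairing (y [^] N) b = 1"
      using b yH pairing_antisym[of y b] by (simp add: pairing_pow_left power_inverse)
  qed (use yH in simp)
  then show ?thesis using y yH by blast
qed

lemma perp_one: "perp {\<one>} = carrier H"
  by (auto simp: perp_def pairing_one_left)

lemma splits_one: "splits {\<one>}"
  by (auto simp: splits_def perp_one)

section \<open>Transvections generate the isometry group\<close>

text \<open>
  The three cases for the element \<open>c\<close> that represents \<open>pairing a a\<close>.  In the third one, put
  \<open>N = 2 ^ h\<close> and \<open>e [^] N = c\<close> with \<open>h\<close> maximal.  The difference \<open>f e \<otimes> inv e\<close> is killed by \<open>N\<close>
  because \<open>f\<close> fixes \<open>c\<close>, and for \<open>h > 0\<close> the square \<open>u = y [^] 2\<close> is a suitable direction for the detour: it is killed by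
  \<open>N\<close>, satisfies \<open>pairing u u = 1\<close> even if \<open>pairing y y = -1\<close>, and its pairings with \<open>e\<close> and \<open>f e\<close>
  both have order \<open>N\<close>, as they become \<open>pairing y c\<close> when raised to the power \<open>N / 2\<close>.
\<close>

lemma trans_group_if_Sp:
  assumes f: "f \<in> carrier Sp"
  shows "f \<in> trans_group"
proof -
  interpret S: group Sp by (rule group_Sp)
  interpret T: subgroup trans_group Sp by (rule trans_group_subgroup)
  interpret f: group_hom H H f using f by (rule Sp_group_hom)
  obtain c where c: "c \<in> carrier H" and q: "\<And>a. a \<in> carrier H \<Longrightarrow> pairing a a = pairing c a"
    by (rule pairing_self_represented) blast
  have c2: "c [^] (2::nat) = \<one>"
  proof (rule nonsingularD)
    fix b assume "b \<in> carrier H"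
    then show "pairing (c [^] (2::nat)) b = 1"
      using c q[of b] pairing_self_square[of b] by (simp add: pairing_pow_left)
  qed (use c in simp)
  have fc: "f c = c"
  proof -
    have "pairing (f c \<otimes> inv c) b = 1" if b: "b \<in> carrier H" for b
    proof -
      obtain a where a: "a \<in> carrier H" "f a = b" using Sp_surj[OF f b] by blast
      have "pairing (f c) b = pairing c b"
        using Sp_pairing[OF f c a(1)] Sp_pairing[OF f a(1) a(1)] a q[OF a(1)] q[OF b] by simp
      then show ?thesis
        using b c pairing_nonzero[OF c b] by (simp add: pairing_mult_left pairing_inv_left)
    qed
    then have "f c \<otimes> inv c = \<one>" using c by (intro nonsingularD) auto
    then show ?thesis using c by (metis f.hom_closed inv_closed inv_equality inv_inv)
  qed
  consider "c = \<one>" | "pairing c c \<noteq> 1" | "c \<noteq> \<one>" "pairing c c = 1" by blast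
  then show ?thesis
  proof cases
    case 1
    show ?thesis
      by (rule trans_group_if_fixes[OF f splits_one])
         (auto simp: perp_one q 1 pairing_one_left fixes_set_def)
  next
    case 2
    have cc: "pairing c c = -1" using 2 pairing_self_square[OF c] by (auto simp: power2_eq_1_iff)
    have "\<exists>k\<in>{\<one>, c}. \<exists>e\<in>perp {\<one>, c}. h = k \<otimes> e" if h: "h \<in> carrier H" for h
    proof (cases "pairing c h = 1")
      case True
      then show ?thesis using h by (auto simp: perp_def pairing_one_left)
    next
      case False
      then have "pairing c h = -1"
        using q[OF h] pairing_self_square[OF h] by (auto simp: power2_eq_1_iff)
      then have "c \<otimes> h \<in> perp {\<one>, c}"
        using c h cc by (simp add: perp_def pairing_one_left pairing_mult_right)
      moreover have "h = c \<otimes> (c \<otimes> h)"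
        using c h c2 by (simp add: m_assoc[symmetric] numeral_2_eq_2)
      ultimately show ?thesis by blast
    qed
    then have "splits {\<one>, c}" using c by (simp add: splits_def)
    then show ?thesis
      by (rule trans_group_if_fixes[OF f]) (auto simp: perp_def q fixes_set_def fc)
  next
    case 3
    define P where "P = (\<lambda>h. \<exists>e\<in>carrier H. e [^] (2 ^ h :: nat) = c)"
    have P0: "P 0" using c by (auto simp: P_def)
    have bound: "h \<le> card (carrier H)" if "P h" for h
    proof -
      obtain e where e: "e \<in> carrier H" "e [^] (2 ^ h :: nat) = c" using \<open>P h\<close> by (auto simp: P_def)
      have "e [^] (2 ^ Suc h :: nat) = \<one>"
        using e c2 by (simp add: power_Suc2 nat_pow_pow[symmetric] del: power_Suc)
      then have "ord e dvd 2 ^ Suc h" using e by (simp add: pow_eq_id)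
      then obtain i where i: "i \<le> Suc h" "ord e = 2 ^ i"
        using divides_primepow_nat[OF two_is_prime_nat] by blast
      have "\<not> ord e dvd 2 ^ h" using e 3(1) by (metis pow_eq_id)
      then have "i = Suc h" using i by (metis le_SucE le_imp_power_dvd)
      have "h < 2 ^ Suc h" by (rule less_trans[OF lessI less_exp])
      also have "\<dots> = ord e" using i \<open>i = Suc h\<close> by simp
      also have "\<dots> \<le> card (carrier H)"
        using ord_le_group_order[OF finite_carrier e(1)] by (simp add: order_def)
      finally show ?thesis by simp
    qed
    define h where "h = Greatest P"
    have "P h" unfolding h_def using P0 bound by (rule GreatestI_nat)
    then obtain e where e: "e \<in> carrier H" "e [^] (2 ^ h :: nat) = c" by (auto simp: P_def)
    have "\<not> P (Suc h)"
      using Greatest_le_nat[of P "Suc h", OF _ bound] by (auto simp: h_def)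
    then obtain y where y: "y \<in> carrier H" "y [^] (2 ^ Suc h :: nat) = \<one>" "pairing y c \<noteq> 1"
      using power_free_partner[OF c, of "2 ^ Suc h"] by (auto simp: P_def)
    have eN: "e [^] (2 ^ Suc h :: nat) = \<one>"
      using e c2 by (simp add: power_Suc2 nat_pow_pow[symmetric] del: power_Suc)
    \<comment> \<open>For \<open>h > 0\<close>, \<open>pairing e e = pairing c e\<close> is a \<open>2 ^ h\<close>-th power of a sign.\<close>
    have ee: "pairing e e = 1"
    proof (cases h)
      case 0
      then show ?thesis using e 3 by simp
    next
      case (Suc h')
      have "pairing e e = pairing e e ^ (2 ^ h)"
        using q[OF e(1)] pairing_pow_left[OF e(1) e(1), of "2 ^ h"] e(2) by simp
      also have "\<dots> = (pairing e e ^ 2) ^ (2 ^ h')" by (simp add: Suc power_mult)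
      finally show ?thesis using pairing_self_square[OF e(1)] by simp
    qed
    have ye: "pairing y e ^ (2 ^ h) \<noteq> 1"
      using y e by (metis pairing_pow_right)
    then have ey: "pairing e y ^ (2 ^ h) \<noteq> 1"
      using y(1) e(1) pairing_antisym[of e y] by (auto simp: power_inverse)
    have oneH: "{\<one>} \<subseteq> carrier H" by simp
    have feH: "f e \<in> carrier H" using e by simp
    have fec: "f e [^] (2 ^ h :: nat) = c"
      using e fc by (metis f.hom_nat_pow)
    obtain g where g: "g \<in> trans_group" "fixes_set (g \<otimes>\<^bsub>Sp\<^esub> f) (insert e {\<one>})"
    proof (cases h)
      case 0
      then have "f e = e" using e fc by simp
      then have "fixes_set (\<one>\<^bsub>Sp\<^esub> \<otimes>\<^bsub>Sp\<^esub> f) (insert e {\<one>})"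
        using f by (simp add: fixes_set_def)
      then show ?thesis using that T.one_closed by blast
    next
      case (Suc h')
      define u where "u = y [^] (2::nat)"
      have uH: "u \<in> carrier H" using y by (simp add: u_def)
      have half: "pairing u z ^ (2 ^ h') \<noteq> 1" if z: "z \<in> carrier H" "z [^] (2 ^ h :: nat) = c" for z
      proof -
        have "pairing u z ^ (2 ^ h') = pairing y z ^ (2 ^ h)"
          using y z by (simp add: u_def pairing_pow_left Suc power_mult)
        also have "\<dots> = pairing y c" using y z by (metis pairing_pow_right)
        finally show ?thesis using y by simp
      qed
      have "\<exists>g\<in>trans_group. fixes_set (g \<otimes>\<^bsub>Sp\<^esub> f) (insert e {\<one>})"
      proof (rule fix_one_more[OF f e(1) oneH _ two_is_prime_nat])
        show "fixes_set f {\<one>}" by (simp add: fixes_set_def)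
        show "(f e \<otimes> inv e) [^] (2 ^ Suc h' :: nat) = \<one>"
          using e feH fec c by (simp add: nat_pow_distrib nat_pow_inv flip: Suc)
        show "u \<in> perp {\<one>}" using uH by (simp add: perp_one)
        show "pairing u u = 1"
          using y pairing_self_square[OF y(1)]
          by (simp add: u_def pairing_pow_left pairing_pow_right)
        show "u [^] (2 ^ Suc h' :: nat) = \<one>"
          using y by (simp add: u_def nat_pow_pow flip: Suc)
        show "pairing u e ^ 2 ^ h' \<noteq> 1" "pairing u (f e) ^ 2 ^ h' \<noteq> 1"
          using half e feH fec by auto
      qed
      then show ?thesis using that by blast
    qed
    have gf: "g \<otimes>\<^bsub>Sp\<^esub> f \<in> carrier Sp" using g(1) f T.mem_carrier by simp
    have eP: "e \<in> perp {\<one>}" and yP: "y \<in> perp {\<one>}" using e y by (auto simp: perp_one)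
    let ?K = "{\<one>} <#> plane e y"
    obtain g' where g': "g' \<in> trans_group" "fixes_set (g' \<otimes>\<^bsub>Sp\<^esub> (g \<otimes>\<^bsub>Sp\<^esub> f)) ?K"
      using fix_plane[OF gf oneH g(2) eP yP two_is_prime_nat eN y(2) ey ee] by blast
    have "c \<in> ?K"
      using in_plane(2)[OF e(1) y(1), of "2 ^ h"] e(2) c by (force simp: set_mult_def)
    then have "pairing a a = 1" if "a \<in> perp ?K" for a
      using that q by (auto simp: perp_def)
    moreover have "splits ?K"
      using splits_plane[OF splits_one eP yP two_is_prime_nat eN y(2) ey ee] .
    moreover have "g' \<otimes>\<^bsub>Sp\<^esub> (g \<otimes>\<^bsub>Sp\<^esub> f) \<in> carrier Sp"
      using gf g'(1) T.mem_carrier by simp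
    ultimately have "g' \<otimes>\<^bsub>Sp\<^esub> (g \<otimes>\<^bsub>Sp\<^esub> f) \<in> trans_group"
      using trans_group_if_fixes g'(2) by blast
    then have "g \<otimes>\<^bsub>Sp\<^esub> f \<in> trans_group" using in_trans_group_if_mult[OF gf g'(1)] by blast
    then show ?thesis using in_trans_group_if_mult[OF f g(1)] by blast
  qed
qed

end

theorem theorem1p1:
  fixes H (structure) and pairing :: "'a \<Rightarrow> 'a \<Rightarrow> complex"
  assumes "symplectic_abelian_group H pairing"
    and "finite (carrier H)"
    and "symplectic_abelian_group.nonsingular H pairing"
  shows "generate (symplectic_abelian_group.Sp H pairing)
           (symplectic_abelian_group.transvections H pairing
             \<inter> carrier (symplectic_abelian_group.Sp H pairing))
         = carrier (symplectic_abelian_group.Sp H pairing)"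
proof -
  interpret finite_symplectic_group H pairing
    using assms by (simp add: finite_symplectic_group_def finite_symplectic_group_axioms_def)
  have "trans_group = carrier Sp"
    using trans_group_if_Sp subgroup.subset[OF trans_group_subgroup] by blast
  then show ?thesis by (simp add: trans_group_def)
qed

end
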